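(* Let $f_1=\sinh\chi\cos\phi$, $f_2=\sinh\chi\sin\phi$, $f_3=\cosh\chi$ on the pseudo-sphere $L^2$, and let $F_1=X_1f_1+Y_1f_2+Z_1f_3$ and $F_2=X_2f_1+Y_2f_2+Z_2f_3$, with real coefficients, be two non zero functions. If $X_1X_2+Y_1Y_2-Z_1Z_2=0$, then the lines $F_1=0$ and $F_2=0$ on the pseudo-sphere meet orthogonally.
   Context: The pseudo-sphere is $L^2=\{x^2+y^2-z^2=-1,\ z>0\}\subset\mathbb{R}^3$ with coordinates $\chi,\phi$ given by $x=\sinh\chi\cos\phi$, $y=\sinh\chi\sin\phi$, $z=\cosh\chi$, and with the metric $ds^2=d\chi^2+\sinh^2\chi\,d\phi^2$ obtained by restricting the pseudo-metric $dx^2+dy^2-dz^2$ of $\mathbb{R}^3$. The line $F=0$ of a function $F=Xf_1+Yf_2+Zf_3$ is its zero set on $L^2$, i.e. the intersection of $L^2$ with the plane $Xx+Yy+Zz=0$ through the origin. Orthogonality of the lines is with respect to this metric.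
   Formalization: That the lines meet is asserted only when both zero sets F_1=0 and F_2=0 are nonempty (for F_1=f_1, F_2=f_3 the condition holds but F_2=0 is empty); orthogonality is asserted at every common point without this hypothesis. *)

theory Defs
  imports "HOL-Analysis.Analysis"
begin

definition minkowski :: "real^3 \<Rightarrow> real^3 \<Rightarrow> real" where
  "minkowski u v = u$1 * v$1 + u$2 * v$2 - u$3 * v$3"

definition pseudosphere :: "(real^3) set" where
  "pseudosphere = {p. (p$1)\<^sup>2 + (p$2)\<^sup>2 - (p$3)\<^sup>2 = -1 \<and> p$3 > 0}"

definition f\<^sub>1 :: "real \<Rightarrow> real \<Rightarrow> real" where
  "f\<^sub>1 chi phi = sinh chi * cos phi"

definition f\<^sub>2 :: "real \<Rightarrow> real \<Rightarrow> real" where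
  "f\<^sub>2 chi phi = sinh chi * sin phi"

definition f\<^sub>3 :: "real \<Rightarrow> real \<Rightarrow> real" where
  "f\<^sub>3 chi phi = cosh chi"

definition point :: "real \<Rightarrow> real \<Rightarrow> real^3" where
  "point chi phi = vector [sinh chi * cos phi, sinh chi * sin phi, cosh chi]"

text \<open>Functions on the pseudo-sphere are given by their expression in the coordinates
  \<open>chi\<close>, \<open>phi\<close>, which range over all of \<open>\<real>\<close>. The coordinates of a point are not unique, but the
  functions used here take the same value at all coordinates of a point.\<close>

definition zero_line :: "(real \<Rightarrow> real \<Rightarrow> real) \<Rightarrow> (real^3) set" where
  "zero_line F = {p \<in> pseudosphere. \<exists>chi phi. p = point chi phi \<and> F chi phi = 0}"

text \<open>Velocities at \<open>p\<close> of curves which stay in \<open>S\<close> near the parameter \<open>0\<close>.\<close>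

definition tangent_vectors :: "(real^3) set \<Rightarrow> real^3 \<Rightarrow> (real^3) set" where
  "tangent_vectors S p =
     {v. \<exists>\<gamma>. \<gamma> 0 = p \<and> (\<forall>\<^sub>F t in at 0. \<gamma> t \<in> S) \<and> (\<gamma> has_vector_derivative v) (at 0)}"

text \<open>Both sets are required to have a genuine (one-dimensional) tangent line at \<open>p\<close>, so that
  orthogonality cannot hold vacuously. The metric of the pseudo-sphere is the restriction of the
  ambient form \<^const>\<open>minkowski\<close>.\<close>

definition meet_orthogonally_at :: "real^3 \<Rightarrow> (real^3) set \<Rightarrow> (real^3) set \<Rightarrow> bool" where
  "meet_orthogonally_at p S T \<longleftrightarrow> p \<in> S \<inter> T \<and>
     (\<exists>v w. v \<noteq> 0 \<and> w \<noteq> 0 \<and> tangent_vectors S p = span {v} \<and> tangent_vectors T p = span {w} \<and>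
            minkowski v w = 0)"

lemma point_nth [simp]:
  "point chi phi $ 1 = f\<^sub>1 chi phi" "point chi phi $ 2 = f\<^sub>2 chi phi" "point chi phi $ 3 = f\<^sub>3 chi phi"
  by (simp_all add: point_def f\<^sub>1_def f\<^sub>2_def f\<^sub>3_def)

lemma pseudosphere_eq_range_point: "pseudosphere = {point chi phi | chi phi. True}"
proof (intro equalityI subsetI)
  fix p assume "p \<in> pseudosphere"
  then have eq: "(p$1)\<^sup>2 + (p$2)\<^sup>2 - (p$3)\<^sup>2 = -1" and pos: "p$3 > 0"
    by (auto simp: pseudosphere_def)
  define r where "r = sqrt ((p$1)\<^sup>2 + (p$2)\<^sup>2)"
  have r2: "r\<^sup>2 = (p$1)\<^sup>2 + (p$2)\<^sup>2" by (simp add: r_def)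
  define phi where "phi = Arg (Complex (p$1) (p$2))"
  have "rcis r phi = Complex (p$1) (p$2)"
    by (metis phi_def r_def complex_norm rcis_cmod_Arg)
  then have phi: "p$1 = r * cos phi" "p$2 = r * sin phi"
    by (metis complex.sel(1) Re_rcis, metis complex.sel(2) Im_rcis)
  have s: "sinh (arsinh r) = r" by simp
  have "(cosh (arsinh r))\<^sup>2 = (p$3)\<^sup>2"
    using cosh_square_eq[of "arsinh r"] r2 eq by simp
  then have "cosh (arsinh r) = p$3"
    using pos by (simp add: power2_eq_iff_nonneg)
  then have "p = point (arsinh r) phi"
    using phi s by (simp add: vec_eq_iff forall_3 f\<^sub>1_def f\<^sub>2_def f\<^sub>3_def)
  then show "p \<in> {point chi phi | chi phi. True}" by blast
next
  fix p assume "p \<in> {point chi phi | chi phi. True}"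
  then obtain chi phi where p: "p = point chi phi" by blast
  have "(sinh chi * cos phi)\<^sup>2 + (sinh chi * sin phi)\<^sup>2 = (sinh chi)\<^sup>2"
    by (simp add: power_mult_distrib flip: distrib_left)
  then show "p \<in> pseudosphere"
    using cosh_square_eq[of chi] by (simp add: p pseudosphere_def f\<^sub>1_def f\<^sub>2_def f\<^sub>3_def)
qed

lemma zero_line_eq_plane_section:
  "zero_line (\<lambda>chi phi. X * f\<^sub>1 chi phi + Y * f\<^sub>2 chi phi + Z * f\<^sub>3 chi phi) =
     pseudosphere \<inter> {p. X * p$1 + Y * p$2 + Z * p$3 = 0}"
proof (intro equalityI subsetI)
  fix p assume "p \<in> pseudosphere \<inter> {p. X * p$1 + Y * p$2 + Z * p$3 = 0}"
  moreover from this obtain chi phi where "p = point chi phi"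
    unfolding pseudosphere_eq_range_point by blast
  ultimately show "p \<in> zero_line (\<lambda>chi phi. X * f\<^sub>1 chi phi + Y * f\<^sub>2 chi phi + Z * f\<^sub>3 chi phi)"
    unfolding zero_line_def by auto
qed (auto simp: zero_line_def)

text \<open>In the coordinates the induced metric is \<open>dchi\<^sup>2 + sinh\<^sup>2 chi dphi\<^sup>2\<close>.\<close>

lemma induced_metric:
  assumes "(c has_real_derivative c') (at t)" "(d has_real_derivative d') (at t)"
  shows "\<exists>v. ((\<lambda>s. point (c s) (d s)) has_vector_derivative v) (at t) \<and>
             minkowski v v = c'\<^sup>2 + (sinh (c t))\<^sup>2 * d'\<^sup>2"
proof -
  define v :: "real^3" where "v = vector
    [cosh (c t) * c' * cos (d t) - sinh (c t) * (sin (d t) * d'),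
     cosh (c t) * c' * sin (d t) + sinh (c t) * (cos (d t) * d'), sinh (c t) * c']"
  have comp: "((\<lambda>s. point (c s) (d s) $ i) has_vector_derivative v $ i) (at t)" for i
    using exhaust_3[of i] unfolding has_real_derivative_iff_has_vector_derivative[symmetric]
    by (auto simp: v_def f\<^sub>1_def f\<^sub>2_def f\<^sub>3_def intro!: derivative_eq_intros assms)
  have "((\<lambda>s. point (c s) (d s)) has_vector_derivative v) (at t)"
    using comp unfolding has_vector_derivative_def
    by (subst has_derivative_componentwise_within)
       (auto simp: Basis_vec_def inner_axis)
  moreover have "minkowski v v =
      (cosh (c t))\<^sup>2 * c'\<^sup>2 * ((sin (d t))\<^sup>2 + (cos (d t))\<^sup>2)
      + (sinh (c t))\<^sup>2 * d'\<^sup>2 * ((sin (d t))\<^sup>2 + (cos (d t))\<^sup>2) - (sinh (c t))\<^sup>2 * c'\<^sup>2"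
    unfolding minkowski_def v_def vector_3 by (simp only: power2_eq_square) algebra
  then have "minkowski v v = c'\<^sup>2 + (sinh (c t))\<^sup>2 * d'\<^sup>2"
    by (simp add: cosh_square_eq algebra_simps)
  ultimately show ?thesis by blast
qed

end

theory Submission
  imports Defs
begin

text \<open>A line \<open>X x + Y y + Z z = 0\<close> is the set of points of the pseudo-sphere which are
  \<^const>\<open>minkowski\<close>-orthogonal to its normal \<open>a = (X, Y, -Z)\<close>, and the hypothesis
  on the coefficients says exactly that the two normals \<open>a\<close> and \<open>b\<close> are orthogonal to each other.

  The tangent line at \<open>p\<close> of the line with normal \<open>a\<close> consists of the vectors orthogonal to both
  \<open>p\<close> and \<open>a\<close> (lemma \<open>tangent_vectors_section\<close>). If \<open>p\<close> also lies on the second line, then \<open>b\<close>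
  is orthogonal to \<open>p\<close> and \<open>a\<close>, so that it spans the tangent of the first line; by symmetry
  \<open>a\<close> spans the tangent of the second one. Thus orthogonality of the tangents is the hypothesis
  read once more.

  That the lines do meet is a signature argument. The tangent plane \<open>p\<^sup>\<bottom>\<close> at a point of the
  pseudo-sphere is positive definite, so the normal of a nonempty line is space-like. Two orthogonal
  space-like vectors leave only a time-like direction orthogonal to both: it is given by their
  Lorentzian cross product (lemma \<open>minkowski_lagrange\<close>), and every time-like line through the
  origin crosses the pseudo-sphere.\<close>

section \<open>The Minkowski form and its cross product\<close>

lemma bilinear_minkowski: "bilinear minkowski"
  unfolding bilinear_def minkowski_def by (auto intro!: linearI simp: algebra_simps)

lemmas minkowski_simps =
  bilinear_ladd[OF bilinear_minkowski] bilinear_radd[OF bilinear_minkowski]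
  bilinear_lmul[OF bilinear_minkowski] bilinear_rmul[OF bilinear_minkowski]

lemma minkowski_commute: "minkowski u v = minkowski v u"
  by (simp add: minkowski_def mult.commute)

lemma bounded_bilinear_minkowski: "bounded_bilinear minkowski"
  using bilinear_minkowski by (simp add: bilinear_conv_bounded_bilinear)

text \<open>The Euclidean cross product with its last component negated: this is what makes the
  result orthogonal to the factors for the Minkowski form.\<close>

definition lorentz_cross :: "real^3 \<Rightarrow> real^3 \<Rightarrow> real^3" where
  "lorentz_cross u v =
     vector [u$2 * v$3 - u$3 * v$2, u$3 * v$1 - u$1 * v$3, u$2 * v$1 - u$1 * v$2]"

lemma lorentz_cross_orthogonal:
  "minkowski (lorentz_cross u v) u = 0" "minkowski (lorentz_cross u v) v = 0"
  by (simp_all add: minkowski_def lorentz_cross_def algebra_simps)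

text \<open>The Lagrange identity; the sign is opposite to the Euclidean one because the form has
  determinant \<open>-1\<close>.\<close>

lemma minkowski_lagrange:
  "minkowski (lorentz_cross u v) (lorentz_cross u v) =
     (minkowski u v)\<^sup>2 - minkowski u u * minkowski v v"
  by (simp add: minkowski_def lorentz_cross_def power2_eq_square algebra_simps)

text \<open>When the cross product \<open>c\<close> is not light-like, this says that the orthogonal complement of
  \<open>u\<close> and \<open>v\<close> is spanned by \<open>c\<close>. The reason is that \<open>w\<close> has zero cross product with \<open>c\<close>, by the
  Lorentzian version \<open>w \<times> (u \<times> v) = <w,u> v - <w,v> u\<close> of the double product formula; crossing
  once more with \<open>c\<close> turns this into a proportionality.\<close>

lemma orthogonal_to_both_parallel_lorentz_cross:
  assumes "minkowski w u = 0" "minkowski w v = 0"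
  shows "minkowski (lorentz_cross u v) (lorentz_cross u v) *\<^sub>R w =
         minkowski w (lorentz_cross u v) *\<^sub>R lorentz_cross u v"
proof -
  let ?c = "lorentz_cross u v"
  have double: "lorentz_cross w ?c = 0"
  proof -
    have "lorentz_cross w ?c = minkowski w u *\<^sub>R v - minkowski w v *\<^sub>R u"
      by (simp add: lorentz_cross_def minkowski_def vec_eq_iff forall_3 algebra_simps)
    then show ?thesis using assms by simp
  qed
  have "lorentz_cross ?c (lorentz_cross w ?c) =
        minkowski ?c w *\<^sub>R ?c - minkowski ?c ?c *\<^sub>R w"
    by (simp add: lorentz_cross_def[of ?c] lorentz_cross_def[of w] minkowski_def vec_eq_iff
        forall_3 algebra_simps)
  then have "minkowski ?c w *\<^sub>R ?c - minkowski ?c ?c *\<^sub>R w = 0"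
    unfolding double by (simp add: lorentz_cross_def vec_eq_iff forall_3)
  then show ?thesis by (simp add: minkowski_commute)
qed

section \<open>Signature along the pseudo-sphere\<close>

lemma pseudosphere_minkowski: "p \<in> pseudosphere \<longleftrightarrow> minkowski p p = -1 \<and> p$3 > 0"
  by (simp add: pseudosphere_def minkowski_def power2_eq_square)

lemma tangent_plane_positive_definite:
  assumes p: "p \<in> pseudosphere" and v: "minkowski v p = 0" and nz: "v \<noteq> 0"
  shows "minkowski v v > 0"
proof -
  have z: "p$3 > 0" and norm: "(p$3)\<^sup>2 = 1 + (p$1)\<^sup>2 + (p$2)\<^sup>2"
    using p by (auto simp: pseudosphere_def)
  have v3: "v$3 * p$3 = v$1 * p$1 + v$2 * p$2"
    using v by (simp add: minkowski_def)
  have "(p$3)\<^sup>2 * minkowski v v = (p$3)\<^sup>2 * ((v$1)\<^sup>2 + (v$2)\<^sup>2) - (v$3 * p$3)\<^sup>2"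
    by (simp add: minkowski_def power2_eq_square algebra_simps)
  also have "\<dots> = (v$1)\<^sup>2 + (v$2)\<^sup>2 + (v$1 * p$2 - v$2 * p$1)\<^sup>2"
    unfolding v3 norm by (simp add: power2_eq_square algebra_simps)
  also have "\<dots> > 0"
  proof -
    have "v$1 \<noteq> 0 \<or> v$2 \<noteq> 0"
    proof (rule ccontr)
      assume "\<not> ?thesis"
      moreover from this have "v$3 = 0" using v3 z by simp
      ultimately show False using nz by (simp add: vec_eq_iff forall_3)
    qed
    then have "(v$1)\<^sup>2 + (v$2)\<^sup>2 > 0" by (simp add: sum_power2_gt_zero_iff)
    then show ?thesis by (simp add: add_pos_nonneg)
  qed
  finally show ?thesis by (simp add: zero_less_mult_iff)
qed

lemma timelike_direction_meets_pseudosphere: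
  assumes "minkowski c c < 0"
  obtains k where "k *\<^sub>R c \<in> pseudosphere"
proof -
  have "c$3 \<noteq> 0"
  proof
    assume "c$3 = 0"
    then have "minkowski c c = (c$1)\<^sup>2 + (c$2)\<^sup>2" by (simp add: minkowski_def power2_eq_square)
    then show False using assms by (simp add: not_sum_power2_lt_zero)
  qed
  \<comment> \<open>The factor \<open>sgn\<close> selects the sheet \<open>z > 0\<close> of the two-sheeted hyperboloid.\<close>
  define k where "k = sgn (c$3) / sqrt (- minkowski c c)"
  have "k\<^sup>2 * minkowski c c = -1"
    using assms \<open>c$3 \<noteq> 0\<close> by (simp add: k_def power_divide sgn_if)
  moreover have "k * c$3 = \<bar>c$3\<bar> / sqrt (- minkowski c c)"
    by (simp add: k_def abs_sgn mult.commute)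
  then have "k * c$3 > 0" using assms \<open>c$3 \<noteq> 0\<close> by simp
  ultimately have "k *\<^sub>R c \<in> pseudosphere"
    by (simp add: pseudosphere_minkowski minkowski_simps power2_eq_square mult.assoc)
  then show thesis using that by blast
qed

section \<open>Tangents of plane sections\<close>

lemma derivative_of_constant_bilinear_pairing:
  assumes "bounded_bilinear B" and const: "\<forall>\<^sub>F t in at 0. B (\<beta> t) (\<gamma> t) = k" "B (\<beta> 0) (\<gamma> 0) = k"
    and \<beta>: "(\<beta> has_vector_derivative v) (at (0::real))"
    and \<gamma>: "(\<gamma> has_vector_derivative w) (at 0)"
  shows "B (\<beta> 0) w + B v (\<gamma> 0) = 0"
proof -
  have "((\<lambda>t. B (\<beta> t) (\<gamma> t)) has_vector_derivative B (\<beta> 0) w + B v (\<gamma> 0)) (at 0)"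
    using bounded_bilinear.has_vector_derivative[OF assms(1) \<beta> \<gamma>] .
  then have "((\<lambda>t. k) has_vector_derivative B (\<beta> 0) w + B v (\<gamma> 0)) (at 0)"
    unfolding has_vector_derivative_def
    using has_derivative_transform_eventually[OF _ const UNIV_I] by blast
  then show ?thesis
    using vector_derivative_unique_at[OF _ has_vector_derivative_const] by blast
qed

text \<open>The tangency conditions are the linearizations of the two equations of the section.
  Conversely, a nonzero vector satisfying them is the velocity of
  \<open>sqrt (1 + <v,v> t\<^sup>2) p + t v\<close>, the intersection of the pseudo-sphere with the plane of \<open>p\<close>
  and \<open>v\<close>, which lies in the section because \<open>p\<close> and \<open>v\<close> are both orthogonal to \<open>a\<close>.\<close>

lemma tangent_vectors_section:
  assumes p: "p \<in> pseudosphere" and ap: "minkowski a p = 0"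
  shows "tangent_vectors (pseudosphere \<inter> {q. minkowski a q = 0}) p =
         {v. minkowski v p = 0 \<and> minkowski v a = 0}"
proof (intro equalityI subsetI)
  fix v assume "v \<in> tangent_vectors (pseudosphere \<inter> {q. minkowski a q = 0}) p"
  then obtain \<gamma> where \<gamma>0: "\<gamma> 0 = p"
    and ev: "\<forall>\<^sub>F t in at 0. \<gamma> t \<in> pseudosphere \<inter> {q. minkowski a q = 0}"
    and der: "(\<gamma> has_vector_derivative v) (at 0)"
    unfolding tangent_vectors_def by blast
  have "\<forall>\<^sub>F t in at 0. minkowski (\<gamma> t) (\<gamma> t) = -1"
    using ev by (rule eventually_mono) (simp add: pseudosphere_minkowski)
  then have "minkowski p v + minkowski v p = 0"
    using derivative_of_constant_bilinear_pairing[OF bounded_bilinear_minkowski _ _ der der] p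
    by (simp add: \<gamma>0 pseudosphere_minkowski)
  moreover have "\<forall>\<^sub>F t in at 0. minkowski a (\<gamma> t) = 0"
    using ev by (rule eventually_mono) simp
  then have "minkowski a v + minkowski 0 p = 0"
    using derivative_of_constant_bilinear_pairing[OF bounded_bilinear_minkowski _ _
        has_vector_derivative_const der] ap
    by (simp add: \<gamma>0)
  ultimately show "v \<in> {v. minkowski v p = 0 \<and> minkowski v a = 0}"
    by (simp add: minkowski_commute bilinear_lzero[OF bilinear_minkowski])
next
  fix v assume "v \<in> {v. minkowski v p = 0 \<and> minkowski v a = 0}"
  then have vp: "minkowski v p = 0" and va: "minkowski v a = 0" by auto
  have q: "minkowski v v \<ge> 0"
    using tangent_plane_positive_definite[OF p vp] bilinear_lzero[OF bilinear_minkowski]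
    by (cases "v = 0") auto
  define \<gamma> where "\<gamma> t = sqrt (1 + minkowski v v * t\<^sup>2) *\<^sub>R p + t *\<^sub>R v" for t
  have der: "(\<gamma> has_vector_derivative v) (at 0)"
  proof -
    have "((\<lambda>t. sqrt (1 + minkowski v v * t\<^sup>2)) has_real_derivative 0) (at 0)"
      by (auto intro!: derivative_eq_intros)
    then show ?thesis
      unfolding \<gamma>_def by (auto intro!: derivative_eq_intros)
  qed
  have hyp: "minkowski (\<gamma> t) (\<gamma> t) = -1" for t
  proof -
    have "1 + minkowski v v * t\<^sup>2 \<ge> 0" using q by simp
    then have root: "sqrt (1 + minkowski v v * t\<^sup>2) * sqrt (1 + minkowski v v * t\<^sup>2)
        = 1 + minkowski v v * t\<^sup>2" by simp
    have pp: "minkowski p p = -1" and pv: "minkowski p v = 0"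
      using p vp by (simp_all add: pseudosphere_minkowski minkowski_commute)
    have "minkowski (\<gamma> t) (\<gamma> t) =
        - (sqrt (1 + minkowski v v * t\<^sup>2) * sqrt (1 + minkowski v v * t\<^sup>2)) + t\<^sup>2 * minkowski v v"
      by (simp add: \<gamma>_def minkowski_simps vp pp pv power2_eq_square del: real_sqrt_mult_self)
    then show ?thesis unfolding root by simp
  qed
  have "\<forall>\<^sub>F t in at 0. \<gamma> t $ 3 > 0"
  proof -
    have "isCont \<gamma> 0" using der has_vector_derivative_continuous by blast
    then have "(\<gamma> \<longlongrightarrow> p) (at 0)" by (simp add: isCont_def \<gamma>_def)
    then have "((\<lambda>t. \<gamma> t $ 3) \<longlongrightarrow> p $ 3) (at 0)" by (rule tendsto_vec_nth)
    then show ?thesis using p by (intro order_tendstoD) (auto simp: pseudosphere_def)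
  qed
  then have "\<forall>\<^sub>F t in at 0. \<gamma> t \<in> pseudosphere \<inter> {q. minkowski a q = 0}"
    by (rule eventually_mono)
       (use hyp ap va in \<open>auto simp: pseudosphere_minkowski \<gamma>_def minkowski_simps minkowski_commute\<close>)
  moreover have "\<gamma> 0 = p" by (simp add: \<gamma>_def)
  ultimately show "v \<in> tangent_vectors (pseudosphere \<inter> {q. minkowski a q = 0}) p"
    using der unfolding tangent_vectors_def by blast
qed

text \<open>The complement of \<open>p\<close> and \<open>a\<close> is a line because their cross product is space-like, by
  Lagrange's identity; any nonzero vector in it is a spanning vector.\<close>

lemma tangent_vectors_section_span:
  assumes p: "p \<in> pseudosphere" and ap: "minkowski a p = 0" and a: "a \<noteq> 0"
    and bp: "minkowski b p = 0" and ba: "minkowski b a = 0" and b: "b \<noteq> 0"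
  shows "tangent_vectors (pseudosphere \<inter> {q. minkowski a q = 0}) p = span {b}"
proof -
  define c where "c = lorentz_cross p a"
  have "minkowski c c = minkowski a a"
    using p ap by (simp add: c_def minkowski_lagrange pseudosphere_minkowski minkowski_commute)
  then have cc: "minkowski c c > 0"
    using tangent_plane_positive_definite[OF p ap a] by simp
  have parallel: "v = (minkowski v c / minkowski c c) *\<^sub>R c"
    if "minkowski v p = 0" "minkowski v a = 0" for v
  proof -
    have "minkowski c c *\<^sub>R v = minkowski v c *\<^sub>R c"
      using orthogonal_to_both_parallel_lorentz_cross[OF that] by (simp add: c_def)
    then have "(1 / minkowski c c) *\<^sub>R (minkowski c c *\<^sub>R v) =
        (1 / minkowski c c) *\<^sub>R (minkowski v c *\<^sub>R c)" by simp
    then show ?thesis using cc by simp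
  qed
  have bc: "minkowski b c \<noteq> 0" using parallel[OF bp ba] b by auto
  have "v \<in> span {b}" if v: "minkowski v p = 0" "minkowski v a = 0" for v
  proof -
    have "(minkowski v c / minkowski b c) *\<^sub>R b =
        (minkowski v c / minkowski b c) *\<^sub>R ((minkowski b c / minkowski c c) *\<^sub>R c)"
      using parallel[OF bp ba] by simp
    also have "\<dots> = (minkowski v c / minkowski c c) *\<^sub>R c" using bc by simp
    also have "\<dots> = v" using parallel[OF v] by simp
    finally show ?thesis by (metis span_base span_scale singletonI)
  qed
  then show ?thesis
    unfolding tangent_vectors_section[OF p ap]
    by (auto simp: span_singleton minkowski_simps bp ba)
qed

section \<open>Lines with orthogonal normals\<close>

lemma sections_meet:
  assumes p: "p \<in> pseudosphere" "minkowski a p = 0" "a \<noteq> 0"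
    and q: "q \<in> pseudosphere" "minkowski b q = 0" "b \<noteq> 0"
    and ab: "minkowski a b = 0"
  obtains r where "r \<in> pseudosphere" "minkowski a r = 0" "minkowski b r = 0"
proof -
  define c where "c = lorentz_cross a b"
  have "minkowski c c = - (minkowski a a * minkowski b b)"
    by (simp add: c_def minkowski_lagrange ab)
  then have "minkowski c c < 0"
    using tangent_plane_positive_definite[OF p] tangent_plane_positive_definite[OF q] by simp
  then obtain k where k: "k *\<^sub>R c \<in> pseudosphere"
    by (rule timelike_direction_meets_pseudosphere)
  have "minkowski a c = 0" "minkowski b c = 0"
    using lorentz_cross_orthogonal[of a b] by (simp_all add: c_def minkowski_commute)
  then show thesis using that[OF k] by (simp add: minkowski_simps)
qed

lemma sections_meet_orthogonally:
  assumes p: "p \<in> pseudosphere" and a: "minkowski a p = 0" "a \<noteq> 0"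
    and b: "minkowski b p = 0" "b \<noteq> 0" and ab: "minkowski a b = 0"
  shows "meet_orthogonally_at p (pseudosphere \<inter> {q. minkowski a q = 0})
           (pseudosphere \<inter> {q. minkowski b q = 0})"
proof -
  have ba: "minkowski b a = 0" using ab by (simp add: minkowski_commute)
  show ?thesis
    unfolding meet_orthogonally_at_def
    using p a b ba tangent_vectors_section_span[OF p a b(1) ba b(2)]
      tangent_vectors_section_span[OF p b a(1) ab a(2)]
    by blast
qed

theorem proposition2p2:
  fixes X\<^sub>1 Y\<^sub>1 Z\<^sub>1 X\<^sub>2 Y\<^sub>2 Z\<^sub>2 :: real
    and F\<^sub>1 F\<^sub>2 :: "real \<Rightarrow> real \<Rightarrow> real"
  assumes F1: "F\<^sub>1 = (\<lambda>chi phi. X\<^sub>1 * f\<^sub>1 chi phi + Y\<^sub>1 * f\<^sub>2 chi phi + Z\<^sub>1 * f\<^sub>3 chi phi)"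
    and F2: "F\<^sub>2 = (\<lambda>chi phi. X\<^sub>2 * f\<^sub>1 chi phi + Y\<^sub>2 * f\<^sub>2 chi phi + Z\<^sub>2 * f\<^sub>3 chi phi)"
    and nz1: "F\<^sub>1 \<noteq> (\<lambda>chi phi. 0)"
    and nz2: "F\<^sub>2 \<noteq> (\<lambda>chi phi. 0)"
    and orth: "X\<^sub>1 * X\<^sub>2 + Y\<^sub>1 * Y\<^sub>2 - Z\<^sub>1 * Z\<^sub>2 = 0"
  shows "(zero_line F\<^sub>1 \<noteq> {} \<and> zero_line F\<^sub>2 \<noteq> {} \<longrightarrow> zero_line F\<^sub>1 \<inter> zero_line F\<^sub>2 \<noteq> {}) \<and>
         (\<forall>p \<in> zero_line F\<^sub>1 \<inter> zero_line F\<^sub>2. meet_orthogonally_at p (zero_line F\<^sub>1) (zero_line F\<^sub>2))"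
proof -
  define n :: "real \<Rightarrow> real \<Rightarrow> real \<Rightarrow> real^3" where "n X Y Z = vector [X, Y, - Z]" for X Y Z
  define a where "a = n X\<^sub>1 Y\<^sub>1 Z\<^sub>1"
  define b where "b = n X\<^sub>2 Y\<^sub>2 Z\<^sub>2"
  have line: "zero_line (\<lambda>chi phi. X * f\<^sub>1 chi phi + Y * f\<^sub>2 chi phi + Z * f\<^sub>3 chi phi) =
      pseudosphere \<inter> {q. minkowski (n X Y Z) q = 0}" for X Y Z
    by (simp add: zero_line_eq_plane_section minkowski_def n_def)
  have L1: "zero_line F\<^sub>1 = pseudosphere \<inter> {q. minkowski a q = 0}"
    and L2: "zero_line F\<^sub>2 = pseudosphere \<inter> {q. minkowski b q = 0}"
    unfolding F1 F2 line a_def b_def by simp_all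
  have a: "a \<noteq> 0" using nz1 by (auto simp: F1 a_def n_def vec_eq_iff forall_3)
  have b: "b \<noteq> 0" using nz2 by (auto simp: F2 b_def n_def vec_eq_iff forall_3)
  have ab: "minkowski a b = 0" using orth by (simp add: a_def b_def n_def minkowski_def)
  have "zero_line F\<^sub>1 \<inter> zero_line F\<^sub>2 \<noteq> {}" if "zero_line F\<^sub>1 \<noteq> {}" "zero_line F\<^sub>2 \<noteq> {}"
  proof -
    from that obtain p q where "p \<in> pseudosphere" "minkowski a p = 0"
      and "q \<in> pseudosphere" "minkowski b q = 0"
      unfolding L1 L2 by blast
    then obtain r where "r \<in> pseudosphere" "minkowski a r = 0" "minkowski b r = 0"
      using sections_meet a b ab by metis
    then show ?thesis unfolding L1 L2 by blast
  qed
  moreover have "meet_orthogonally_at p (zero_line F\<^sub>1) (zero_line F\<^sub>2)"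
    if "p \<in> zero_line F\<^sub>1 \<inter> zero_line F\<^sub>2" for p
    using that a b ab sections_meet_orthogonally unfolding L1 L2 by blast
  ultimately show ?thesis by blast
qed

end
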